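(* Let $L$ be a regular Lagrangian of order $k\ge 1$ such that $\mathbb{C}_1(L)=aL$ for a constant $a\neq 1$, and let $S$ be its canonical semispray of order $2k-1$. Then $[\mathbb{C}_1,S]=S$.
   Context: All objects are smooth. $M$ is a real $n$-dimensional smooth manifold. For $r\ge 1$, $T^rM=J^r_0M$ is the bundle of $r$-jets at $0$ of curves from neighbourhoods of $0\in\mathbb{R}$ to $M$, with induced local coordinates $(x^i,y^{(1)i},\dots,y^{(r)i})$, where $y^{(\alpha)i}(j^r_0c)=\frac{1}{\alpha!}\frac{d^\alpha (x^i\circ c)}{dt^\alpha}\big|_{t=0}$, and $y^{(0)i}:=x^i$. Functions on $T^kM$ are identified with their pull-backs to $T^{2k-1}M$. $T^r_0M=\{y^{(1)}\ne0\}\subset T^rM$; homogeneous objects that are not polynomial in the fibre coordinates are considered on $T^r_0M$ instead of $T^rM$. Tangent structure on $T^rM$: $J=\sum_{\alpha=1}^{r}\frac{\partial}{\partial y^{(\alpha)i}}\otimes dy^{(\alpha-1)i}$; $J^\alpha$ is its $\alpha$-fold composition. Liouville vector fields: $\mathbb{C}_\alpha=\sum_{\beta=1}^{r+1-\alpha}\beta\, y^{(\beta)i}\frac{\partial}{\partial y^{(\alpha+\beta-1)i}}$, $\alpha\in\{1,\dots,r\}$. For a function $f$, $d_{J^\alpha}f=df\circ J^\alpha$. A semispray of order $r$ is a vector field $S$ on $T^rM$ with $JS=\mathbb{C}_1$. A Lagrangian of order $k$ is a function $L$ on $T^kM$. With $J$, $\mathbb{C}_\alpha$ taken on $T^{2k-1}M$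 and $S'$ any semispray of order $2k-1$ (the result does not depend on the choice), set $$\theta_L=\sum_{\alpha=1}^k\frac{(-1)^{\alpha-1}}{\alpha!}\mathcal{L}_{S'}^{\alpha-1}d_{J^\alpha}L,\quad \omega_L=-d\theta_L,\quad \mathcal{E}_L=\sum_{\alpha=1}^k\frac{(-1)^{\alpha-1}}{\alpha!}\mathcal{L}_{S'}^{\alpha-1}\mathbb{C}_\alpha(L)-L .$$ $L$ is regular if $\omega_L$ is a symplectic form on $T^{2k-1}M$. The canonical semispray (Euler-Lagrange vector field) of a regular Lagrangian $L$ of order $k$ is the unique semispray $S$ of order $2k-1$ satisfying $i_S\omega_L=d\mathcal{E}_L$ (equivalently $\mathcal{L}_S\theta_L=dL$). *)

theory Defs
  imports "HOL-Analysis.Analysis"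
begin

section \<open>Smooth manifolds\<close>

primrec Ck_on :: "nat \<Rightarrow> 'a::real_normed_vector set \<Rightarrow> ('a \<Rightarrow> 'b::real_normed_vector) \<Rightarrow> bool" where
  "Ck_on 0 D f \<longleftrightarrow> continuous_on D f"
| "Ck_on (Suc m) D f \<longleftrightarrow>
     (\<forall>x\<in>D. f differentiable (at x)) \<and>
     (\<forall>v. Ck_on m D (\<lambda>x. frechet_derivative f (at x) v))"

text \<open>To be used for open \<open>D\<close> only.\<close>

definition smooth_map_on :: "'a::real_normed_vector set \<Rightarrow> ('a \<Rightarrow> 'b::real_normed_vector) \<Rightarrow> bool" where
  "smooth_map_on D f \<longleftrightarrow> (\<forall>m. Ck_on m D f)"

type_synonym ('a, 'n) chart = "'a set \<times> ('a \<Rightarrow> real^'n)"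

abbreviation chart_dom :: "('a, 'n) chart \<Rightarrow> 'a set" where
  "chart_dom c \<equiv> fst c"

abbreviation chart_map :: "('a, 'n) chart \<Rightarrow> 'a \<Rightarrow> real^'n" where
  "chart_map c \<equiv> snd c"

abbreviation chart_inv :: "('a, 'n) chart \<Rightarrow> real^'n \<Rightarrow> 'a" where
  "chart_inv c \<equiv> inv_into (chart_dom c) (chart_map c)"

definition is_chart :: "'a topology \<Rightarrow> ('a, 'n::finite) chart \<Rightarrow> bool" where
  "is_chart M c \<longleftrightarrow>
     openin M (chart_dom c) \<and> open (chart_map c ` chart_dom c) \<and>
     homeomorphic_map (subtopology M (chart_dom c))
       (top_of_set (chart_map c ` chart_dom c)) (chart_map c)"

text \<open>The smooth structure is given by an atlas, which may be maximal but need not be.\<close>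

definition smooth_manifold :: "'a topology \<Rightarrow> ('a, 'n::finite) chart set \<Rightarrow> bool" where
  "smooth_manifold M A \<longleftrightarrow>
     Hausdorff_space M \<and> second_countable M \<and>
     (\<forall>c\<in>A. is_chart M c) \<and> (\<Union>c\<in>A. chart_dom c) = topspace M \<and>
     (\<forall>c\<in>A. \<forall>d\<in>A. smooth_map_on (chart_map c ` (chart_dom c \<inter> chart_dom d))
                      (chart_map d \<circ> chart_inv c))"


section \<open>Jets of curves and the induced coordinates\<close>

text \<open>A curve defined near \<open>0\<close> is a total function whose values away from \<open>0\<close> are
  irrelevant.\<close>

definition smooth_curve :: "('a, 'n::finite) chart set \<Rightarrow> (real \<Rightarrow> 'a) \<Rightarrow> bool" where
  "smooth_curve A \<gamma> \<longleftrightarrow>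
     (\<exists>c\<in>A. \<exists>e>0. \<gamma> ` {-e<..<e} \<subseteq> chart_dom c \<and> smooth_map_on {-e<..<e} (chart_map c \<circ> \<gamma>))"

definition curve_coord :: "('a, 'n::finite) chart \<Rightarrow> nat \<times> 'n \<Rightarrow> (real \<Rightarrow> 'a) \<Rightarrow> real" where
  "curve_coord c I \<gamma> = (deriv ^^ fst I) (\<lambda>t. chart_map c (\<gamma> t) $ snd I) 0 / fact (fst I)"

type_synonym 'a jet = "(real \<Rightarrow> 'a) set"

text \<open>The \<open>r\<close>-jet of \<open>\<gamma>\<close> at \<open>0\<close>, as an equivalence class of curves.\<close>

definition jet :: "('a, 'n::finite) chart set \<Rightarrow> nat \<Rightarrow> (real \<Rightarrow> 'a) \<Rightarrow> 'a jet" where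
  "jet A r \<gamma> = {\<delta>. smooth_curve A \<delta> \<and> \<delta> 0 = \<gamma> 0 \<and>
     (\<forall>c\<in>A. \<gamma> 0 \<in> chart_dom c \<longrightarrow>
        (\<forall>\<alpha>\<le>r. \<forall>i. curve_coord c (\<alpha>, i) \<delta> = curve_coord c (\<alpha>, i) \<gamma>))}"

text \<open>The coordinate function \<open>y\<^sup>(\<^sup>\<alpha>\<^sup>)\<^sup>i\<close> on jets of order at least \<open>\<alpha>\<close>,
  where \<open>I = (\<alpha>, i)\<close>.\<close>

definition jet_coord :: "('a, 'n::finite) chart \<Rightarrow> nat \<times> 'n \<Rightarrow> 'a jet \<Rightarrow> real" where
  "jet_coord c I p = curve_coord c I (SOME \<gamma>. \<gamma> \<in> p)"

text \<open>
  A point of a coordinate space is a function \<open>u\<close> with \<open>u (\<alpha>, i) = y\<^sup>(\<^sup>\<alpha>\<^sup>)\<^sup>i\<close>, the levels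
  \<open>\<alpha>\<close> running through all natural numbers. The parametrisation of \<open>T\<^sup>rM\<close> by the
  induced coordinates (the inverse of the induced chart) only uses the levels \<open>\<alpha> \<le> r\<close>, so the
  local expression of a function on \<open>T\<^sup>rM\<close> is a function of \<open>u\<close> that depends on these
  levels only. In this way one coordinate space serves all orders, and a function on \<open>T\<^sup>kM\<close>
  and its pull-back to \<open>T\<^sup>rM\<close>, \<open>k \<le> r\<close>, have the same local expression.
\<close>

type_synonym 'n coords = "nat \<times> 'n \<Rightarrow> real"

definition jet_param ::
    "('a, 'n::finite) chart set \<Rightarrow> nat \<Rightarrow> ('a, 'n) chart \<Rightarrow> 'n coords \<Rightarrow> 'a jet" where
  "jet_param A r c u = jet A r (\<lambda>t. chart_inv c (\<Sum>\<alpha>\<le>r. t ^ \<alpha> *\<^sub>R (\<chi> i. u (\<alpha>, i))))"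

text \<open>The coordinate domain over the chart \<open>c\<close>: of \<open>T\<^sup>rM\<close> if \<open>slit\<close> is false,
  and of \<open>T\<^sup>r\<^sub>0M = {y\<^sup>(\<^sup>1\<^sup>) \<noteq> 0}\<close> if \<open>slit\<close> is true.\<close>

definition coord_dom :: "bool \<Rightarrow> ('a, 'n::finite) chart \<Rightarrow> 'n coords set" where
  "coord_dom slit c = {u. (\<chi> i. u (0, i)) \<in> chart_map c ` chart_dom c \<and>
                          (slit \<longrightarrow> (\<exists>i. u (1, i) \<noteq> 0))}"

definition levels :: "nat \<Rightarrow> (nat \<times> 'n::finite) set" where
  "levels r = {..r} \<times> UNIV"

definition pd :: "nat \<times> 'n \<Rightarrow> ('n coords \<Rightarrow> real) \<Rightarrow> 'n coords \<Rightarrow> real" where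
  "pd K f u = deriv (\<lambda>t. f (u(K := t))) (u K)"

text \<open>Smoothness in coordinates: all iterated partial derivatives exist and are continuous
  (for the product topology; only functions of finitely many levels are considered).\<close>

primrec Ck_coords :: "nat \<Rightarrow> 'n::finite coords set \<Rightarrow> ('n coords \<Rightarrow> real) \<Rightarrow> bool" where
  "Ck_coords 0 D f \<longleftrightarrow> continuous_on D f"
| "Ck_coords (Suc m) D f \<longleftrightarrow> continuous_on D f \<and>
     (\<forall>K. (\<forall>u\<in>D. (\<lambda>t. f (u(K := t))) differentiable (at (u K))) \<and> Ck_coords m D (pd K f))"

definition smooth_coords :: "'n::finite coords set \<Rightarrow> ('n coords \<Rightarrow> real) \<Rightarrow> bool" where
  "smooth_coords D f \<longleftrightarrow> (\<forall>m. Ck_coords m D f)"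


section \<open>Functions and vector fields on the jet bundle\<close>

definition local_fun ::
    "('a, 'n::finite) chart set \<Rightarrow> nat \<Rightarrow> ('a jet \<Rightarrow> real) \<Rightarrow> ('a, 'n) chart \<Rightarrow> 'n coords \<Rightarrow> real" where
  "local_fun A r f c u = f (jet_param A r c u)"

text \<open>A smooth function on \<open>T\<^sup>rM\<close> (on \<open>T\<^sup>r\<^sub>0M\<close> if \<open>slit\<close> is true); for
  \<open>r = k\<close> this is a Lagrangian of order \<open>k\<close>.\<close>

definition smooth_function ::
    "('a, 'n::finite) chart set \<Rightarrow> bool \<Rightarrow> nat \<Rightarrow> ('a jet \<Rightarrow> real) \<Rightarrow> bool" where
  "smooth_function A slit r f \<longleftrightarrow> (\<forall>c\<in>A. smooth_coords (coord_dom slit c) (local_fun A r f c))"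

text \<open>A tangent vector is given by its components with respect to all induced charts at its base
  point, related by the Jacobian matrices of the coordinate changes; a vector field assigns to a
  jet \<open>p\<close> and a chart \<open>c\<close> the components at \<open>p\<close> with respect to \<open>c\<close>.\<close>

type_synonym ('a, 'n) field = "'a jet \<Rightarrow> ('a, 'n) chart \<Rightarrow> nat \<times> 'n \<Rightarrow> real"

type_synonym 'n local_field = "nat \<times> 'n \<Rightarrow> 'n coords \<Rightarrow> real"
type_synonym 'n local_form = "nat \<times> 'n \<Rightarrow> 'n coords \<Rightarrow> real"
type_synonym 'n local_form2 = "nat \<times> 'n \<Rightarrow> nat \<times> 'n \<Rightarrow> 'n coords \<Rightarrow> real"

definition local_vf ::
    "('a, 'n::finite) chart set \<Rightarrow> nat \<Rightarrow> ('a, 'n) field \<Rightarrow> ('a, 'n) chart \<Rightarrow> 'n local_field" where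
  "local_vf A r X c I u = X (jet_param A r c u) c I"

definition vector_field ::
    "('a, 'n::finite) chart set \<Rightarrow> bool \<Rightarrow> nat \<Rightarrow> ('a, 'n) field \<Rightarrow> bool" where
  "vector_field A slit r X \<longleftrightarrow>
     (\<forall>c\<in>A. \<forall>I\<in>levels r. smooth_coords (coord_dom slit c) (local_vf A r X c I)) \<and>
     (\<forall>c\<in>A. \<forall>d\<in>A. \<forall>u\<in>coord_dom slit c. chart_inv c (\<chi> i. u (0, i)) \<in> chart_dom d \<longrightarrow>
        (\<forall>I\<in>levels r. X (jet_param A r c u) d I =
           (\<Sum>K\<in>levels r. pd K (\<lambda>w. jet_coord d I (jet_param A r c w)) u * X (jet_param A r c u) c K)))"


section \<open>Calculus in induced coordinates on \<open>T\<^sup>rM\<close>\<close>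

definition vf_apply :: "nat \<Rightarrow> 'n::finite local_field \<Rightarrow> ('n coords \<Rightarrow> real) \<Rightarrow> 'n coords \<Rightarrow> real" where
  "vf_apply r X f u = (\<Sum>K\<in>levels r. X K u * pd K f u)"

definition lie_bracket :: "nat \<Rightarrow> 'n::finite local_field \<Rightarrow> 'n local_field \<Rightarrow> 'n local_field" where
  "lie_bracket r X Y I u = vf_apply r X (Y I) u - vf_apply r Y (X I) u"

definition lie_deriv_form :: "nat \<Rightarrow> 'n::finite local_field \<Rightarrow> 'n local_form \<Rightarrow> 'n local_form" where
  "lie_deriv_form r X \<theta> I u =
     vf_apply r X (\<theta> I) u + (\<Sum>K\<in>levels r. \<theta> K u * pd I (X K) u)"

definition ext_d :: "'n::finite local_form \<Rightarrow> 'n local_form2" where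
  "ext_d \<theta> I K u = pd I (\<theta> K) u - pd K (\<theta> I) u"

definition contract :: "nat \<Rightarrow> 'n::finite local_field \<Rightarrow> 'n local_form2 \<Rightarrow> 'n local_form" where
  "contract r X \<omega> K u = (\<Sum>I\<in>levels r. X I u * \<omega> I K u)"

definition symplectic_on :: "nat \<Rightarrow> 'n::finite coords set \<Rightarrow> 'n local_form2 \<Rightarrow> bool" where
  "symplectic_on r D \<omega> \<longleftrightarrow>
     (\<forall>I\<in>levels r. \<forall>K\<in>levels r. smooth_coords D (\<omega> I K)) \<and>
     (\<forall>u\<in>D.
        (\<forall>I\<in>levels r. \<forall>K\<in>levels r. \<omega> I K u = - \<omega> K I u) \<and>
        (\<forall>H\<in>levels r. \<forall>I\<in>levels r. \<forall>K\<in>levels r.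
           pd H (\<omega> I K) u + pd I (\<omega> K H) u + pd K (\<omega> H I) u = 0) \<and>
        (\<forall>v. (\<forall>K\<in>levels r. (\<Sum>I\<in>levels r. v I * \<omega> I K u) = 0) \<longrightarrow> (\<forall>I\<in>levels r. v I = 0)))"

text \<open>\<open>J\<close> maps the coordinate vector \<open>(\<alpha> - 1, i)\<close> to \<open>(\<alpha>, i)\<close>, hence shifts components up
  by one level.\<close>

definition tangent_J :: "nat \<Rightarrow> (nat \<times> 'n \<Rightarrow> real) \<Rightarrow> nat \<times> 'n \<Rightarrow> real" where
  "tangent_J r v = (\<lambda>(\<alpha>, i). if \<alpha> \<in> {1..r} then v (\<alpha> - 1, i) else 0)"

text \<open>The component \<open>I\<close> of \<open>d\<^bsub>J\<^sup>\<alpha>\<^esub>f = df \<circ> J\<^sup>\<alpha>\<close> is its value on the coordinate vector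
  field \<open>I\<close>.\<close>

definition d_J :: "nat \<Rightarrow> nat \<Rightarrow> ('n::finite coords \<Rightarrow> real) \<Rightarrow> 'n local_form" where
  "d_J r \<alpha> f I u =
     (\<Sum>K\<in>levels r. pd K f u * (tangent_J r ^^ \<alpha>) (\<lambda>H. if H = I then 1 else 0) K)"

definition liouville :: "nat \<Rightarrow> nat \<Rightarrow> 'n local_field" where
  "liouville r \<alpha> = (\<lambda>(\<gamma>, i) u.
     \<Sum>\<beta> = 1..r + 1 - \<alpha>. if \<gamma> = \<alpha> + \<beta> - 1 then real \<beta> * u (\<beta>, i) else 0)"

definition semispray :: "('a, 'n::finite) chart set \<Rightarrow> bool \<Rightarrow> nat \<Rightarrow> ('a, 'n) field \<Rightarrow> bool" where
  "semispray A slit r S \<longleftrightarrow> vector_field A slit r S \<and>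
     (\<forall>c\<in>A. \<forall>u\<in>coord_dom slit c. \<forall>K\<in>levels r.
        tangent_J r (\<lambda>I. local_vf A r S c I u) K = liouville r 1 K u)"


section \<open>Lagrangians of order \<open>k\<close>\<close>

text \<open>In the following local expressions on \<open>T\<^sup>2\<^sup>k\<^sup>-\<^sup>1M\<close>, \<open>S'\<close> is the local expression of
  an auxiliary semispray of order \<open>2k - 1\<close> and \<open>f\<close> that of a function on
  \<open>T\<^sup>kM\<close>. The results do not depend on the choice of the semispray.\<close>

definition theta :: "nat \<Rightarrow> 'n::finite local_field \<Rightarrow> ('n coords \<Rightarrow> real) \<Rightarrow> 'n local_form" where
  "theta k S' f I u = (\<Sum>\<alpha> = 1..k. (-1) ^ (\<alpha> - 1) / fact \<alpha> *
     (lie_deriv_form (2 * k - 1) S' ^^ (\<alpha> - 1)) (d_J (2 * k - 1) \<alpha> f) I u)"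

definition omega :: "nat \<Rightarrow> 'n::finite local_field \<Rightarrow> ('n coords \<Rightarrow> real) \<Rightarrow> 'n local_form2" where
  "omega k S' f I K u = - ext_d (theta k S' f) I K u"

definition energy :: "nat \<Rightarrow> 'n::finite local_field \<Rightarrow> ('n coords \<Rightarrow> real) \<Rightarrow> 'n coords \<Rightarrow> real" where
  "energy k S' f u = (\<Sum>\<alpha> = 1..k. (-1) ^ (\<alpha> - 1) / fact \<alpha> *
     (vf_apply (2 * k - 1) S' ^^ (\<alpha> - 1)) (vf_apply (2 * k - 1) (liouville (2 * k - 1) \<alpha>) f) u) - f u"

definition regular_lagrangian ::
    "('a, 'n::finite) chart set \<Rightarrow> bool \<Rightarrow> nat \<Rightarrow> ('a, 'n) field \<Rightarrow> ('a jet \<Rightarrow> real) \<Rightarrow> bool" where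
  "regular_lagrangian A slit k S' L \<longleftrightarrow> smooth_function A slit k L \<and>
     (\<forall>c\<in>A. symplectic_on (2 * k - 1) (coord_dom slit c)
        (omega k (local_vf A (2 * k - 1) S' c) (local_fun A k L c)))"

text \<open>If \<open>L\<close> is regular, non-degeneracy makes the field \<open>S\<close> unique.\<close>

definition canonical_semispray ::
    "('a, 'n::finite) chart set \<Rightarrow> bool \<Rightarrow> nat \<Rightarrow> ('a, 'n) field \<Rightarrow> ('a jet \<Rightarrow> real) \<Rightarrow>
     ('a, 'n) field \<Rightarrow> bool" where
  "canonical_semispray A slit k S' L S \<longleftrightarrow> semispray A slit (2 * k - 1) S \<and>
     (\<forall>c\<in>A. \<forall>u\<in>coord_dom slit c. \<forall>K\<in>levels (2 * k - 1).
        contract (2 * k - 1) (local_vf A (2 * k - 1) S c)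
          (omega k (local_vf A (2 * k - 1) S' c) (local_fun A k L c)) K u =
        pd K (energy k (local_vf A (2 * k - 1) S' c) (local_fun A k L c)) u)"

end

theory Submission imports Defs begin

text \<open>
  The equation \<open>i\<^sub>S \<omega>\<^sub>L = d\<E>\<^sub>L\<close> determines \<open>S\<close>, and both \<open>\<omega>\<^sub>L\<close> and \<open>\<E>\<^sub>L\<close>
  inherit the homogeneity of \<open>L\<close>; hence \<open>S\<close> is homogeneous as well. Instead of computing with
  Lie derivatives along \<open>\<C>\<^sub>1\<close>, which would require commutators and the symmetry of second
  derivatives, the proof uses the flow of \<open>\<C>\<^sub>1\<close>. In the coordinates of one chart this is the
  dilation \<open>h\<^sub>s\<close> that multiplies \<open>y\<^sup>(\<^sup>\<gamma>\<^sup>)\<^sup>i\<close> by \<open>s\<^sup>\<gamma>\<close>, so it acts on a coordinate domain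
  and reduces everything to counting exponents of \<open>s\<close>.

  \<^item> By the chain rule, \<open>\<C>\<^sub>1(g) = d g\<close> is equivalent to \<open>g \<circ> h\<^sub>s = s\<^sup>d g\<close> for \<open>s > 0\<close>
    (\<open>homogeneous_if_euler\<close>, \<open>euler_if_homogeneous\<close>). The derivative with respect to
    \<open>y\<^sup>(\<^sup>\<gamma>\<^sup>)\<^sup>i\<close> lowers the degree \<open>d\<close> by \<open>\<gamma>\<close> (\<open>homogeneous_pd\<close>).
  \<^item> The semispray \<open>S'\<close> in \<open>\<theta>\<^sub>L\<close> and \<open>\<E>\<^sub>L\<close> is arbitrary and need not be
    homogeneous. But the components of a semispray of order \<open>2k - 1\<close> below the top level are those of
    the total derivative, and the top level never enters: the functions differentiated along
    \<open>S'\<close> have order at most \<open>2k - 2\<close>, and the forms of which a Lie derivative is taken have no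
    components above level \<open>k - 2\<close>.
    So \<open>S'\<close> may be replaced by the total derivative, which raises degrees by one
    (\<open>theta_summand\<close>, \<open>energy_summand\<close>).
  \<^item> Hence the component of \<open>\<theta>\<^sub>L\<close> at level \<open>\<gamma>\<close> has degree \<open>a - 1 - \<gamma>\<close>, the component of
    \<open>\<omega>\<^sub>L\<close> at levels \<open>\<gamma>, \<delta>\<close> has degree \<open>a - 1 - \<gamma> - \<delta>\<close>, and \<open>\<E>\<^sub>L\<close> has degree \<open>a\<close>.
    Comparing \<open>i\<^sub>S \<omega>\<^sub>L = d\<E>\<^sub>L\<close> at \<open>u\<close> and at \<open>h\<^sub>s u\<close>, non-degeneracy of \<open>\<omega>\<^sub>L\<close> at
    \<open>u\<close> shows that the component of \<open>S\<close> at level \<open>\<gamma>\<close> has degree \<open>\<gamma> + 1\<close>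
    (\<open>solution_components_dilation\<close>).
  \<^item> The bracket with \<open>\<C>\<^sub>1\<close> multiplies such a component by \<open>(\<gamma> + 1) - \<gamma> = 1\<close>
    (\<open>liouville_bracket\<close>).
\<close>

section \<open>Partial derivatives in jet coordinates\<close>

(* Indices (level, component) are treated as atoms rather than split into pairs. *)
declare split_paired_All [simp del]

lemma line_continuous: "continuous_on UNIV (\<lambda>t. (u::'b \<Rightarrow> real)(K := t))"
proof (rule continuous_on_coordinatewise_then_product)
  show "continuous_on UNIV (\<lambda>t. (u(K := t)) i)" for i
    by (cases "i = K") (auto intro: continuous_intros)
qed

lemma eventually_line_in_open:
  assumes "open D" and "(u::'b \<Rightarrow> real) \<in> D"
  shows "\<forall>\<^sub>F t in nhds (u K). u(K := t) \<in> D"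
proof -
  have "open ((\<lambda>t. u(K := t)) -` D)"
    using open_vimage[OF assms(1) line_continuous[of u K]] .
  then have "\<forall>\<^sub>F t in nhds (u K). t \<in> (\<lambda>t. u(K := t)) -` D"
    by (rule eventually_nhds_in_open) (simp add: assms(2))
  then show ?thesis by simp
qed

lemma pd_cong_on:
  assumes "open D" "u \<in> D" "\<And>w. w \<in> D \<Longrightarrow> f w = g w"
  shows "pd K f u = pd K g u"
  unfolding pd_def
  by (rule deriv_cong_ev[OF eventually_mono[OF eventually_line_in_open[OF assms(1,2)]] refl])
     (rule assms(3))

lemma pd_unique:
  "((\<lambda>t. f (u(K := t))) has_real_derivative d) (at (u K)) \<Longrightarrow> pd K f u = d"
  unfolding pd_def by (rule DERIV_imp_deriv)

lemma has_pd:
  assumes "Ck_coords (Suc m) D f" "u \<in> D"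
  shows "((\<lambda>t. f (u(K := t))) has_real_derivative pd K f u) (at (u K))"
  using assms unfolding pd_def DERIV_deriv_iff_real_differentiable Ck_coords.simps by blast

lemma has_pd_smooth:
  assumes "smooth_coords D f" "u \<in> D"
  shows "((\<lambda>t. f (u(K := t))) has_real_derivative pd K f u) (at (u K))"
  using assms has_pd[of 0 D f] unfolding smooth_coords_def by blast

text \<open>Auxiliary fields are only controlled on the coordinate domain; as it is open along every
  coordinate line, functions that agree there may be exchanged under iterated derivatives.\<close>

lemma Ck_coords_cong:
  assumes "open D" "Ck_coords m D f" "\<And>u. u \<in> D \<Longrightarrow> f u = g u"
  shows "Ck_coords m D g"
  using assms(2,3)
proof (induction m arbitrary: f g)
  case 0
  then show ?case by (simp cong: continuous_on_cong)
next
  case (Suc m)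
  have "(\<lambda>t. g (u(K := t))) differentiable at (u K)" if "u \<in> D" for u K
  proof -
    have "((\<lambda>t. g (u(K := t))) has_real_derivative pd K f u) (at (u K))"
      by (rule DERIV_cong_ev[THEN iffD1, OF refl _ refl has_pd[OF Suc.prems(1) that]])
         (rule eventually_mono[OF eventually_line_in_open[OF assms(1) that] Suc.prems(2)])
    then show ?thesis by (rule differentiableI[OF has_field_derivative_imp_has_derivative])
  qed
  moreover have "Ck_coords m D (pd K g)" for K
  proof (rule Suc.IH)
    show "Ck_coords m D (pd K f)" using Suc.prems(1) by simp
    show "pd K f u = pd K g u" if "u \<in> D" for u
      by (rule pd_cong_on[OF assms(1) that Suc.prems(2)])
  qed
  moreover have "continuous_on D g"
    using Suc.prems by (auto cong: continuous_on_cong)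
  ultimately show ?case by simp
qed

lemma Ck_coords_Suc: "Ck_coords (Suc m) D f \<Longrightarrow> Ck_coords m D f"
  by (induction m arbitrary: f) auto

text \<open>Differentiability and the value of the derivative are obtained together, so that the closure
  properties below need only the one-variable differentiation rules.\<close>

lemma Ck_coords_SucI:
  assumes "open D" "continuous_on D f"
    and "\<And>u K. u \<in> D \<Longrightarrow> ((\<lambda>t. f (u(K := t))) has_real_derivative f' K u) (at (u K))"
    and "\<And>K. Ck_coords m D (f' K)"
  shows "Ck_coords (Suc m) D f"
proof -
  have "Ck_coords m D (pd K f)" for K
    by (rule Ck_coords_cong[OF assms(1) assms(4)[of K]]) (use pd_unique assms(3) in metis)
  moreover have "(\<lambda>t. f (u(K := t))) differentiable at (u K)" if "u \<in> D" for u K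
    using assms(3)[OF that] real_differentiable_def by blast
  ultimately show ?thesis using assms(2) by simp
qed

lemma Ck_coords_const:
  assumes "open D" shows "Ck_coords m D (\<lambda>u. c)"
proof (induction m arbitrary: c)
  case (Suc m)
  then show ?case
    by (intro Ck_coords_SucI[OF assms, where f' = "\<lambda>K u. 0"]) (auto intro!: derivative_eq_intros)
qed simp

lemma Ck_coords_coord:
  assumes "open D" shows "Ck_coords m D (\<lambda>u. u I)"
proof (cases m)
  case 0
  then show ?thesis
    using continuous_on_subset[OF continuous_on_product_coordinates] by auto
next
  case (Suc n)
  have "((\<lambda>t. (u(K := t)) I) has_real_derivative (if K = I then 1 else 0)) (at (u K))" for u :: "'a coords" and K
    by (cases "K = I") (auto intro!: derivative_eq_intros)
  then show ?thesis
    unfolding Suc using Ck_coords_const[OF assms]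
    by (intro Ck_coords_SucI[OF assms, where f' = "\<lambda>K u. if K = I then 1 else 0"])
       (auto intro: continuous_on_subset[OF continuous_on_product_coordinates])
qed

lemma Ck_coords_add:
  assumes "open D" "Ck_coords m D f" "Ck_coords m D g"
  shows "Ck_coords m D (\<lambda>u. f u + g u)"
  using assms(2,3)
proof (induction m arbitrary: f g)
  case (Suc m)
  show ?case
    by (rule Ck_coords_SucI[OF assms(1), where f' = "\<lambda>K u. pd K f u + pd K g u"])
       (use Suc in \<open>auto simp del: fun_upd_apply
          intro!: continuous_intros DERIV_add[OF has_pd has_pd]\<close>)
qed (auto intro: continuous_intros)

lemma Ck_coords_mult:
  assumes "open D" "Ck_coords m D f" "Ck_coords m D g"
  shows "Ck_coords m D (\<lambda>u. f u * g u)"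
  using assms(2,3)
proof (induction m arbitrary: f g)
  case (Suc m)
  show ?case
  proof (rule Ck_coords_SucI[OF assms(1), where f' = "\<lambda>K u. pd K f u * g u + pd K g u * f u"])
    show "((\<lambda>t. f (u(K := t)) * g (u(K := t))) has_real_derivative
        pd K f u * g u + pd K g u * f u) (at (u K))" if "u \<in> D" for u K
      using DERIV_mult[OF has_pd[OF Suc.prems(1) that, of K] has_pd[OF Suc.prems(2) that, of K]]
      by (simp only: fun_upd_triv)
    show "Ck_coords m D (\<lambda>u. pd K f u * g u + pd K g u * f u)" for K
      using Suc Ck_coords_Suc[OF Suc.prems(1)] Ck_coords_Suc[OF Suc.prems(2)] by (auto intro!: Ck_coords_add assms(1))
  qed (use Suc.prems in \<open>auto intro!: continuous_intros\<close>)
qed (auto intro: continuous_intros)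

text \<open>The coordinates in \<open>G\<close> are released one at a time. Releasing a further coordinate
  \<open>K\<close> amounts to a function of two real variables, the old parameter and the value of \<open>K\<close>;
  it is differentiable because its second partial derivative exists and is continuous. The
  remaining coordinates keep their values from \<open>u\<close>, which does not affect a function of
  order \<open>r\<close> when \<open>G\<close> consists of the levels up to \<open>r\<close>.\<close>

lemma chain_rule_coords:
  fixes x :: "real \<Rightarrow> 'n::finite coords"
  assumes "open D" and "Ck_coords 1 D f" and "finite G"
    and x: "\<And>K s. ((\<lambda>s. x s K) has_real_derivative x' K s) (at s)"
    and u: "x s0 = u" "u \<in> D"
  shows "((\<lambda>s. f (override_on u (x s) G)) has_real_derivative
           (\<Sum>K\<in>G. x' K s0 * pd K f u)) (at s0)"
  using \<open>finite G\<close>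
proof (induction G rule: finite_induct)
  case empty
  then show ?case by (simp add: override_on_def)
next
  case (insert K G)
  define y where "y = (\<lambda>(s, t). (override_on u (x s) G)(K := t))"
  have xc: "continuous_on UNIV (\<lambda>s. x s I)" for I
    using x by (meson DERIV_continuous continuous_at_imp_continuous_on)
  have "continuous_on UNIV (\<lambda>p. y p I)" for I
  proof (cases "I = K")
    case True
    then show ?thesis by (simp add: y_def case_prod_beta continuous_intros)
  next
    case False
    have "continuous_on UNIV (\<lambda>p::real\<times>real. x (fst p) I)"
      by (rule continuous_on_compose2[OF xc]) (auto intro: continuous_intros)
    with False show ?thesis
      by (cases "I \<in> G") (auto simp: y_def case_prod_beta override_on_def)
  qed
  then have yc: "continuous_on UNIV y" by (rule continuous_on_coordinatewise_then_product)
  have y0: "y (s0, u K) = u" using u(1) by (auto simp: y_def override_on_def)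
  have "open (y -` D)" by (rule open_vimage[OF assms(1) yc])
  \<comment> \<open>A product neighbourhood with convex second factor, as the two-variable criterion requires.\<close>
  then obtain X Y0 where XY0: "open X" "open Y0" "s0 \<in> X" "u K \<in> Y0" "X \<times> Y0 \<subseteq> y -` D"
    using y0 u(2) by (auto elim!: open_prod_elim[of _ "(s0, u K)"])
  then obtain e where e: "e > 0" "ball (u K) e \<subseteq> Y0" by (meson open_contains_ball)
  define Y where "Y = ball (u K) e"
  have XY: "open X" "open Y" "s0 \<in> X" "u K \<in> Y" "convex Y"
    and yD: "\<And>s t. s \<in> X \<Longrightarrow> t \<in> Y \<Longrightarrow> y (s, t) \<in> D"
    using XY0 e by (auto simp: Y_def subset_iff)
  let ?F = "\<lambda>s t. f (y (s, t))"
  let ?fy = "\<lambda>s t. blinfun_scaleR_left (pd K f (y (s, t)))"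
  have "((\<lambda>(s, t). ?F s t) has_derivative
      (\<lambda>(ts, tt). ts * (\<Sum>K\<in>G. x' K s0 * pd K f u) + ?fy s0 (u K) tt)) (at (s0, u K) within X \<times> Y)"
  proof (rule has_derivative_partialsI)
    have "f (y (s, u K)) = f (override_on u (x s) G)" for s
      by (rule arg_cong[where f = f]) (use insert.hyps in \<open>auto simp: y_def override_on_def\<close>)
    then show "((\<lambda>s. ?F s (u K)) has_derivative (\<lambda>ts. ts * (\<Sum>K\<in>G. x' K s0 * pd K f u))) (at s0 within X)"
      using insert.IH[THEN has_field_derivative_imp_has_derivative, THEN has_derivative_at_withinI, of X]
      by (simp add: mult.commute[of _ "\<Sum>K\<in>G. x' K s0 * pd K f u"])
    show "((\<lambda>t. ?F s t) has_derivative blinfun_apply (?fy s t)) (at t within Y)" if "s \<in> X" "t \<in> Y" for s t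
    proof -
      have "((\<lambda>r. f ((y (s, t))(K := r))) has_real_derivative pd K f (y (s, t))) (at (y (s, t) K))"
        using has_pd[of 0 D f "y (s,t)"] assms(2) yD[OF that] by simp
      then have "((\<lambda>r. ?F s r) has_real_derivative pd K f (y (s, t))) (at t)"
        by (simp add: y_def)
      then have "((\<lambda>r. ?F s r) has_derivative (\<lambda>h. h * pd K f (y (s, t)))) (at t)"
        by (simp add: has_field_derivative_def mult.commute[of _ "pd K f (y (s, t))"])
      then show ?thesis by (simp add: has_derivative_at_withinI)
    qed
    have "continuous_on D (pd K f)" using assms(2) by simp
    then have "continuous_on (X \<times> Y) (\<lambda>p. pd K f (y p))"
      by (rule continuous_on_compose2[OF _ continuous_on_subset[OF yc]]) (use yD in auto)
    then have "continuous_on (X \<times> Y) (\<lambda>p. blinfun_scaleR_left (pd K f (y p)))"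
      by (intro bounded_linear.continuous_on[OF bounded_linear_blinfun_scaleR_left])
    then show "continuous (at (s0, u K) within X \<times> Y) (\<lambda>(s, t). ?fy s t)"
      using XY by (simp add: case_prod_beta' continuous_on_eq_continuous_within)
  qed (use XY in auto)
  then have "((\<lambda>(s, t). ?F s t) has_derivative
      (\<lambda>(ts, tt). ts * (\<Sum>K\<in>G. x' K s0 * pd K f u) + tt * pd K f u)) (at (s0, u K))"
    using XY by (subst (asm) at_within_open) (auto simp: open_Times y0)
  moreover have "((\<lambda>s. (s, x s K)) has_derivative (\<lambda>h. (h, h * x' K s0))) (at s0)"
    using x[of K s0] by (auto intro!: derivative_eq_intros simp: has_field_derivative_def mult.commute)
  ultimately have "((\<lambda>s. ?F s (x s K)) has_derivative
      (\<lambda>h. h * (\<Sum>K\<in>G. x' K s0 * pd K f u) + h * x' K s0 * pd K f u)) (at s0)"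
    using u(1) by (auto dest!: has_derivative_compose[of "\<lambda>s. (s, x s K)"] simp: case_prod_beta)
  then have "((\<lambda>s. ?F s (x s K)) has_real_derivative (\<Sum>K\<in>insert K G. x' K s0 * pd K f u)) (at s0)"
    by (rule has_derivative_imp_has_field_derivative) (use insert.hyps in \<open>simp add: algebra_simps\<close>)
  moreover have "y (s, x s K) = override_on u (x s) (insert K G)" for s
    by (auto simp: y_def override_on_def)
  ultimately show ?case by simp
qed

section \<open>Functions of bounded order\<close>

text \<open>The counterpart, for local expressions, of being the pull-back of a function on
  \<open>T\<^sup>mM\<close>. It is required on the whole coordinate space, not just on a coordinate domain, which
  makes it stable under partial derivatives without further conditions.\<close>

definition order_le :: "nat \<Rightarrow> ('n::finite coords \<Rightarrow> real) \<Rightarrow> bool" where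
  "order_le m g \<longleftrightarrow> (\<forall>u v. (\<forall>K\<in>levels m. u K = v K) \<longrightarrow> g u = g v)"

lemma finite_levels [simp]: "finite (levels r :: (nat \<times> 'n::finite) set)"
  by (simp add: levels_def)

lemma in_levels [simp]: "K \<in> levels r \<longleftrightarrow> fst K \<le> r"
  by (cases K) (simp add: levels_def)

lemma order_leI: "(\<And>u v. (\<And>K. fst K \<le> m \<Longrightarrow> u K = v K) \<Longrightarrow> g u = g v) \<Longrightarrow> order_le m g"
  unfolding order_le_def by (metis in_levels)

lemma order_leD: "order_le m g \<Longrightarrow> (\<And>K. fst K \<le> m \<Longrightarrow> u K = v K) \<Longrightarrow> g u = g v"
  unfolding order_le_def by (metis in_levels)

lemma order_le_mono: "order_le m g \<Longrightarrow> m \<le> n \<Longrightarrow> order_le n g"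
  by (rule order_leI) (metis order_leD le_trans)

lemma order_le_mult: "order_le m f \<Longrightarrow> order_le m g \<Longrightarrow> order_le m (\<lambda>u. f u * g u)"
  by (rule order_leI) (metis order_leD)

lemma order_le_add: "order_le m f \<Longrightarrow> order_le m g \<Longrightarrow> order_le m (\<lambda>u. f u + g u)"
  by (rule order_leI) (metis order_leD)

lemma order_le_const: "order_le m (\<lambda>u. c)"
  by (rule order_leI) simp

lemma order_le_sum:
  "(\<And>K. K \<in> F \<Longrightarrow> order_le m (f K)) \<Longrightarrow> order_le m (\<lambda>u. \<Sum>K\<in>F. f K u)"
  by (rule order_leI, rule sum.cong[OF refl]) (rule order_leD)

lemma pd_above_order:
  assumes "order_le m g" "m < fst K" shows "pd K g u = 0"
proof (rule pd_unique)
  have "g (u(K := t)) = g u" for t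
    by (rule order_leD[OF assms(1)]) (use assms(2) in auto)
  then show "((\<lambda>t. g (u(K := t))) has_real_derivative 0) (at (u K))" by simp
qed

lemma order_le_pd:
  assumes "order_le m g" shows "order_le m (pd K g)"
proof (cases "fst K \<le> m")
  case True
  show ?thesis
  proof (rule order_leI)
    fix u v :: "'a coords" assume uv: "\<And>I. fst I \<le> m \<Longrightarrow> u I = v I"
    have "g (u(K := t)) = g (v(K := t))" for t
      by (rule order_leD[OF assms]) (simp add: uv)
    then show "pd K g u = pd K g v" using uv[OF True] by (simp add: pd_def)
  qed
next
  case False
  then have "pd K g = (\<lambda>u. 0)" using pd_above_order[OF assms, of K] by (simp add: fun_eq_iff)
  then show ?thesis by (simp add: order_le_const)
qed

text \<open>Only the components of \<open>X\<close> up to the order of \<open>g\<close> contribute.\<close>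

lemma order_le_vf_apply:
  assumes g: "order_le m g" and X: "\<And>K. fst K \<le> m \<Longrightarrow> order_le n (X K)" and "m \<le> n"
  shows "order_le n (vf_apply r X g)"
  unfolding vf_apply_def
proof (rule order_le_sum)
  fix K :: "nat \<times> 'a"
  show "order_le n (\<lambda>u. X K u * pd K g u)"
  proof (cases "fst K \<le> m")
    case True
    then show ?thesis using X order_le_pd[OF g] order_le_mono[OF _ \<open>m \<le> n\<close>] by (blast intro: order_le_mult)
  next
    case False
    then show ?thesis by (simp add: pd_above_order[OF g] order_le_const)
  qed
qed

section \<open>Homogeneity under the flow of the Liouville field\<close>

lemma liouville_apply:
  assumes "\<alpha> \<ge> 1"
  shows "liouville r \<alpha> (\<gamma>, i) u =
    (if \<alpha> \<le> \<gamma> \<and> \<gamma> \<le> r then real (\<gamma> + 1 - \<alpha>) * u (\<gamma> + 1 - \<alpha>, i) else 0)"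
proof -
  have "liouville r \<alpha> (\<gamma>, i) u =
      (\<Sum>\<beta> = 1..r + 1 - \<alpha>. if \<beta> = \<gamma> + 1 - \<alpha> \<and> \<alpha> \<le> \<gamma> then real \<beta> * u (\<beta>, i) else 0)"
    unfolding liouville_def prod.case by (rule sum.cong[OF refl]) (use assms in auto)
  also have "\<dots> = (if \<alpha> \<le> \<gamma> \<and> \<gamma> \<le> r then real (\<gamma> + 1 - \<alpha>) * u (\<gamma> + 1 - \<alpha>, i) else 0)"
    using assms by (cases "\<alpha> \<le> \<gamma>") auto
  finally show ?thesis .
qed

lemma vf_apply_liouville_1:
  "vf_apply r (liouville r 1) g u = (\<Sum>K\<in>levels r. real (fst K) * u K * pd K g u)"
  unfolding vf_apply_def
proof (rule sum.cong[OF refl])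
  fix K :: "nat \<times> 'a" assume "K \<in> levels r"
  then show "liouville r 1 K u * pd K g u = real (fst K) * u K * pd K g u"
    by (cases K, cases "fst K") (simp_all add: liouville_apply)
qed

text \<open>For \<open>s > 0\<close>, this is the flow of \<open>\<C>\<^sub>1\<close> at time \<open>ln s\<close>.\<close>

definition dilation :: "real \<Rightarrow> 'n coords \<Rightarrow> 'n coords" where
  "dilation s u = (\<lambda>K. s ^ fst K * u K)"

locale dilation_invariant_region =
  fixes D :: "'n::finite coords set"
  assumes open_D: "open D"
    and dilation_D: "\<And>s u. u \<in> D \<Longrightarrow> s > 0 \<Longrightarrow> dilation s u \<in> D"
begin

text \<open>Smoothness is included because without it \<open>pd\<close> may be a junk value, which does not
  scale. The factor \<open>s powr d\<close> allows an arbitrary real degree.\<close>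

definition homogeneous :: "real \<Rightarrow> ('n coords \<Rightarrow> real) \<Rightarrow> bool" where
  "homogeneous d g \<longleftrightarrow> smooth_coords D g \<and>
     (\<forall>u\<in>D. \<forall>s>0. g (dilation s u) = s powr d * g u)"

lemma homogeneous_zero: "homogeneous d (\<lambda>u. 0)"
  by (simp add: homogeneous_def smooth_coords_def Ck_coords_const open_D)

lemma homogeneous_const: "homogeneous 0 (\<lambda>u. c)"
  by (simp add: homogeneous_def smooth_coords_def Ck_coords_const open_D)

lemma homogeneous_coord: "homogeneous (real (fst I)) (\<lambda>u. u I)"
  by (simp add: homogeneous_def smooth_coords_def Ck_coords_coord open_D dilation_def powr_realpow)

lemma homogeneous_add:
  "homogeneous d f \<Longrightarrow> homogeneous d g \<Longrightarrow> homogeneous d (\<lambda>u. f u + g u)"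
  by (simp add: homogeneous_def smooth_coords_def Ck_coords_add open_D distrib_left)

lemma homogeneous_mult:
  "homogeneous d f \<Longrightarrow> homogeneous e g \<Longrightarrow> homogeneous (d + e) (\<lambda>u. f u * g u)"
  by (simp add: homogeneous_def smooth_coords_def Ck_coords_mult open_D powr_add)

lemma homogeneous_cmult: "homogeneous d f \<Longrightarrow> homogeneous d (\<lambda>u. c * f u)"
  using homogeneous_mult[OF homogeneous_const] by simp

lemma homogeneous_diff:
  assumes "homogeneous d f" "homogeneous d g" shows "homogeneous d (\<lambda>u. f u - g u)"
  using homogeneous_add[OF assms(1) homogeneous_cmult[OF assms(2), of "-1"]] by simp

lemma homogeneous_sum:
  assumes "\<And>K. K \<in> F \<Longrightarrow> homogeneous d (f K)"
  shows "homogeneous d (\<lambda>u. \<Sum>K\<in>F. f K u)"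
  using assms
  by (induction F rule: infinite_finite_induct) (auto intro: homogeneous_zero homogeneous_add)

lemma homogeneous_cong:
  assumes "homogeneous d f" "\<And>u. u \<in> D \<Longrightarrow> f u = g u" shows "homogeneous d g"
  using assms Ck_coords_cong[OF open_D] dilation_D
  unfolding homogeneous_def smooth_coords_def by metis

text \<open>Moving the coordinate \<open>K\<close> of \<open>h\<^sub>s u\<close> to \<open>t\<close> is the same as moving that of \<open>u\<close> to
  \<open>t / s\<^sup>\<gamma>\<close>, where \<open>\<gamma>\<close> is the level of \<open>K\<close>, and then applying \<open>h\<^sub>s\<close>; so the
  one-variable chain rule yields the factor \<open>s\<^sup>-\<^sup>\<gamma>\<close>.\<close>

lemma homogeneous_pd:
  assumes "homogeneous d g" shows "homogeneous (d - real (fst K)) (pd K g)"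
proof -
  have smooth: "smooth_coords D g" using assms by (simp add: homogeneous_def)
  have "Ck_coords m D (pd K g)" for m
  proof -
    have "Ck_coords (Suc m) D g" using smooth by (simp only: smooth_coords_def)
    then show ?thesis by simp
  qed
  moreover have "pd K g (dilation s u) = s powr (d - real (fst K)) * pd K g u"
    if u: "u \<in> D" and s: "s > 0" for u s
  proof (rule pd_unique)
    let ?c = "s ^ fst K"
    have c: "?c > 0" using s by (rule zero_less_power)
    have eq: "(dilation s u)(K := t) = dilation s (u(K := t / ?c))" for t
      using s by (simp add: dilation_def fun_eq_iff)
    have u_K: "dilation s u K / ?c = u K" using s by (simp add: dilation_def)
    have "filterlim (\<lambda>t. t / ?c) (nhds (dilation s u K / ?c)) (nhds (dilation s u K))"
      by (intro tendsto_intros filterlim_ident) (use c in linarith)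
    then have "\<forall>\<^sub>F t in nhds (dilation s u K). u(K := t / ?c) \<in> D"
      using eventually_line_in_open[OF open_D u] unfolding u_K filterlim_iff by blast
    then have ev: "\<forall>\<^sub>F t in nhds (dilation s u K).
        s powr d * g (u(K := t / ?c)) = g ((dilation s u)(K := t))"
      by eventually_elim (use assms s eq in \<open>auto simp: homogeneous_def\<close>)
    have "((\<lambda>t. g (u(K := t))) has_real_derivative pd K g u) (at (dilation s u K / ?c))"
      unfolding u_K by (rule has_pd_smooth[OF smooth u])
    moreover have "((\<lambda>t. t / ?c) has_real_derivative 1 / ?c) (at (dilation s u K))"
      using DERIV_cdivide[OF DERIV_ident] .
    ultimately have "((\<lambda>t. g (u(K := t / ?c))) has_real_derivative pd K g u * (1 / ?c))
        (at (dilation s u K))"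
      by (rule DERIV_chain2)
    then have "((\<lambda>t. s powr d * g (u(K := t / ?c))) has_real_derivative
        s powr d * (pd K g u * (1 / ?c))) (at (dilation s u K))"
      by (rule DERIV_cmult)
    moreover have "s powr d * (pd K g u * (1 / ?c)) = s powr (d - real (fst K)) * pd K g u"
      using s by (simp add: powr_diff powr_realpow)
    ultimately show "((\<lambda>t. g ((dilation s u)(K := t))) has_real_derivative
        s powr (d - real (fst K)) * pd K g u) (at (dilation s u K))"
      using DERIV_cong_ev[OF refl ev refl] by simp
  qed
  ultimately show ?thesis by (simp add: homogeneous_def smooth_coords_def)
qed

text \<open>A vector field whose component at level \<open>\<gamma>\<close> has degree \<open>\<gamma> + w\<close> raises degrees by
  \<open>w\<close>. For forms, whose component at level \<open>\<gamma>\<close> has degree \<open>d - \<gamma>\<close>, the same holds of the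
  Lie derivative.\<close>

lemma homogeneous_vf_apply:
  assumes X: "\<And>K. homogeneous (real (fst K) + w) (X K)" and g: "homogeneous d g"
  shows "homogeneous (d + w) (vf_apply r X g)"
proof -
  have "homogeneous (d + w) (\<lambda>u. X K u * pd K g u)" for K
    using homogeneous_mult[OF X homogeneous_pd[OF g], of K K] by (simp add: add.commute)
  then show ?thesis unfolding vf_apply_def by (intro homogeneous_sum)
qed

lemma homogeneous_lie_deriv_form:
  assumes X: "\<And>K. homogeneous (real (fst K) + w) (X K)"
    and \<theta>: "\<And>K. homogeneous (d - real (fst K)) (\<theta> K)"
  shows "homogeneous (d + w - real (fst I)) (lie_deriv_form r X \<theta> I)"
proof -
  have "homogeneous (d + w - real (fst I)) (\<lambda>u. \<theta> K u * pd I (X K) u)" for K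
    using homogeneous_mult[OF \<theta> homogeneous_pd[OF X], of K K I] by (simp add: algebra_simps)
  moreover have "homogeneous (d + w - real (fst I)) (vf_apply r X (\<theta> I))"
    using homogeneous_vf_apply[OF X \<theta>, of I r] by (simp add: algebra_simps)
  ultimately show ?thesis unfolding lie_deriv_form_def
    by (intro homogeneous_add homogeneous_sum)
qed

lemma dilation_derivative:
  assumes g: "smooth_coords D g" "order_le r g" and u: "u \<in> D" and s: "s > 0"
  shows "((\<lambda>s. g (dilation s u)) has_real_derivative vf_apply r (liouville r 1) g (dilation s u) / s) (at s)"
proof -
  let ?w = "dilation s u"
  have "((\<lambda>s. g (override_on ?w (dilation s u) (levels r))) has_real_derivative
      (\<Sum>K\<in>levels r. (real (fst K) * s ^ (fst K - 1) * u K) * pd K g ?w)) (at s)"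
  proof (rule chain_rule_coords[where D = D])
    show "Ck_coords 1 D g" using g(1) by (simp only: smooth_coords_def)
    show "((\<lambda>s. dilation s u K) has_real_derivative real (fst K) * s ^ (fst K - 1) * u K) (at s)" for K s
      by (auto simp: dilation_def intro!: derivative_eq_intros)
  qed (use open_D dilation_D u s in auto)
  moreover have "g (override_on ?w (dilation t u) (levels r)) = g (dilation t u)" for t
    by (rule order_leD[OF g(2)]) simp
  moreover have "real (fst K) * s ^ (fst K - 1) * u K = real (fst K) * ?w K / s" for K
    using s by (cases "fst K") (auto simp: dilation_def)
  ultimately show ?thesis by (simp only: vf_apply_liouville_1) (simp add: sum_divide_distrib)
qed

text \<open>The function \<open>s\<^sup>-\<^sup>d g(h\<^sub>s u)\<close> of \<open>s > 0\<close> has derivative zero, so it equals its value at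
  \<open>s = 1\<close>.\<close>

lemma homogeneous_if_euler:
  assumes g: "smooth_coords D g" "order_le r g"
    and euler: "\<And>u. u \<in> D \<Longrightarrow> vf_apply r (liouville r 1) g u = d * g u"
  shows "homogeneous d g"
  unfolding homogeneous_def
proof (intro conjI ballI allI impI)
  fix u and s :: real assume u: "u \<in> D" and s: "s > 0"
  let ?\<phi> = "\<lambda>s. s powr (- d) * g (dilation s u)"
  have "(?\<phi> has_real_derivative 0) (at s within {0<..})" if "s \<in> {0<..}" for s
  proof -
    have s: "s > 0" using that by simp
    have "((\<lambda>s. g (dilation s u)) has_real_derivative d * g (dilation s u) / s) (at s)"
      using dilation_derivative[OF g u s] euler dilation_D[OF u s] by simp
    then have "(?\<phi> has_real_derivative
        (- d) * s powr (- d - 1) * g (dilation s u) + d * g (dilation s u) / s * s powr (- d)) (at s)"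
      using s by (auto intro!: DERIV_mult derivative_eq_intros)
    then have "(?\<phi> has_real_derivative 0) (at s)"
      using s by (simp add: powr_diff)
    then show ?thesis by (rule has_field_derivative_at_within)
  qed
  then obtain c where "\<forall>s\<in>{0<..}. ?\<phi> s = c"
    using has_field_derivative_zero_constant[of "{0<..}" ?\<phi>] by auto
  then have "?\<phi> s = ?\<phi> 1" using s by (metis greaterThan_iff zero_less_one)
  then show "g (dilation s u) = s powr d * g u"
    using s by (simp add: dilation_def powr_minus field_simps)
qed (rule g)

lemma euler_if_homogeneous:
  assumes g: "homogeneous d g" "order_le r g" and u: "u \<in> D"
  shows "vf_apply r (liouville r 1) g u = d * g u"
proof -
  have d1: "dilation 1 u = u" by (simp add: dilation_def)
  have euler: "((\<lambda>s. g (dilation s u)) has_real_derivative vf_apply r (liouville r 1) g u) (at 1)"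
    using dilation_derivative[OF _ g(2) u zero_less_one] g(1)
    by (simp only: d1 homogeneous_def div_by_1)
  have "((\<lambda>s. s powr d * g u) has_real_derivative d * g u) (at 1)"
    by (auto intro!: derivative_eq_intros)
  moreover have "\<forall>\<^sub>F s in nhds 1. s powr d * g u = g (dilation s u)"
  proof -
    have "\<forall>\<^sub>F s in nhds (1::real). s > 0"
      using eventually_nhds_in_open[of "{0<..}" "1::real"] by simp
    then show ?thesis by eventually_elim (use g(1) u in \<open>auto simp: homogeneous_def\<close>)
  qed
  ultimately have "((\<lambda>s. g (dilation s u)) has_real_derivative d * g u) (at 1)"
    using DERIV_cong_ev[OF refl _ refl, THEN iffD1] by fast
  with euler show ?thesis by (rule DERIV_unique)
qed

text \<open>The first term of the bracket is \<open>(\<gamma> + 1) S\<^sup>I\<close> by Euler's identity, the second is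
  \<open>S(\<gamma> u\<^sup>I) = \<gamma> S\<^sup>I\<close>, where \<open>\<gamma>\<close> is the level of \<open>I\<close>.\<close>

lemma liouville_bracket:
  assumes S: "homogeneous (real (fst I) + 1) (S I)" "order_le r (S I)" and I: "I \<in> levels r"
    and u: "u \<in> D"
  shows "lie_bracket r (liouville r 1) S I u = S I u"
proof -
  have "vf_apply r (liouville r 1) (S I) u = (real (fst I) + 1) * S I u"
    by (rule euler_if_homogeneous[OF S u])
  moreover have "vf_apply r S (liouville r 1 I) u = real (fst I) * S I u"
  proof -
    have "liouville r 1 I = (\<lambda>u. real (fst I) * u I)"
      using I by (cases I, cases "fst I") (auto simp: fun_eq_iff liouville_apply)
    moreover have "pd K (\<lambda>u. real (fst I) * u I) u = (if K = I then real (fst I) else 0)" for K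
      by (rule pd_unique) (auto intro!: derivative_eq_intros)
    ultimately have "vf_apply r S (liouville r 1 I) u =
        (\<Sum>K\<in>levels r. if K = I then S I u * real (fst I) else 0)"
      unfolding vf_apply_def by (intro sum.cong) auto
    then show ?thesis using I by (simp add: mult.commute)
  qed
  ultimately show ?thesis by (simp add: lie_bracket_def algebra_simps)
qed

end

section \<open>Semisprays and the total derivative\<close>

text \<open>The total derivative \<open>d/dt\<close> of functions of order less than \<open>r\<close>, made into a semispray of
  order \<open>r\<close> in the given coordinates by choosing zero for the components at level \<open>r\<close>.\<close>

definition total_derivative :: "nat \<Rightarrow> 'n::finite local_field" where
  "total_derivative r = (\<lambda>(\<gamma>, i) u. if \<gamma> < r then real (\<gamma> + 1) * u (\<gamma> + 1, i) else 0)"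

lemma order_le_total_derivative: "fst K \<le> m \<Longrightarrow> order_le (m + 1) (total_derivative r K)"
  by (rule order_leI) (auto simp: total_derivative_def case_prod_beta)

lemma tangent_J_funpow:
  "\<beta> \<le> r \<Longrightarrow> (tangent_J r ^^ \<alpha>) v (\<beta>, i) = (if \<alpha> \<le> \<beta> then v (\<beta> - \<alpha>, i) else 0)"
proof (induction \<alpha> arbitrary: \<beta>)
  case (Suc \<alpha>)
  then show ?case by (cases \<beta>) (simp_all add: tangent_J_def)
qed simp

lemma d_J_apply:
  "d_J r \<alpha> f (\<gamma>, i) u = (if \<gamma> + \<alpha> \<le> r then pd (\<gamma> + \<alpha>, i) f u else 0)"
proof -
  have "d_J r \<alpha> f (\<gamma>, i) u = (\<Sum>K\<in>levels r. if K = (\<gamma> + \<alpha>, i) then pd K f u else 0)"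
    unfolding d_J_def
  proof (rule sum.cong[OF refl])
    fix K :: "nat \<times> 'a" assume K: "K \<in> levels r"
    show "pd K f u * (tangent_J r ^^ \<alpha>) (\<lambda>H. if H = (\<gamma>, i) then 1 else 0) K =
        (if K = (\<gamma> + \<alpha>, i) then pd K f u else 0)"
      using K by (cases K) (auto simp: tangent_J_funpow)
  qed
  then show ?thesis by simp
qed

text \<open>\<open>J S = \<C>\<^sub>1\<close> fixes every component of a semispray except those at the top level.\<close>

lemma semispray_components:
  assumes "semispray A slit r X" "c \<in> A" "u \<in> coord_dom slit c" "fst K < r"
  shows "local_vf A r X c K u = total_derivative r K u"
proof -
  obtain \<gamma> i where K: "K = (\<gamma>, i)" by (cases K)
  have "tangent_J r (\<lambda>I. local_vf A r X c I u) (\<gamma> + 1, i) = liouville r 1 (\<gamma> + 1, i) u"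
    using assms by (auto simp: semispray_def K)
  then show ?thesis
    using assms(4) by (simp add: tangent_J_def liouville_apply total_derivative_def K)
qed

context dilation_invariant_region
begin

text \<open>A function of order less than \<open>r\<close> is not differentiated in the top level, where \<open>X\<close> is
  unknown. In the Lie derivative of a form the top level of \<open>X\<close> is moreover multiplied by the top
  level of the form, which is assumed to vanish. The function and the form themselves are replaced
  at the same time, so that the two lemmas can be iterated.\<close>

lemma vf_apply_eq_total_derivative:
  assumes X: "\<And>K u. fst K < r \<Longrightarrow> u \<in> D \<Longrightarrow> X K u = total_derivative r K u"
    and g: "\<And>u. u \<in> D \<Longrightarrow> g u = g0 u" "order_le m g0" "m < r" and u: "u \<in> D"
  shows "vf_apply r X g u = vf_apply r (total_derivative r) g0 u"
  unfolding vf_apply_def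
proof (rule sum.cong[OF refl])
  fix K :: "nat \<times> 'n"
  have eq: "pd K g u = pd K g0 u" using pd_cong_on[OF open_D u g(1)] .
  show "X K u * pd K g u = total_derivative r K u * pd K g0 u"
  proof (cases "fst K < r")
    case True
    then show ?thesis using X u eq by simp
  next
    case False
    then have "pd K g0 u = 0" using g(2,3) by (intro pd_above_order) auto
    then show ?thesis using eq by simp
  qed
qed

lemma lie_deriv_form_eq_total_derivative:
  assumes X: "\<And>K u. fst K < r \<Longrightarrow> u \<in> D \<Longrightarrow> X K u = total_derivative r K u"
    and \<theta>: "\<And>K u. u \<in> D \<Longrightarrow> \<theta> K u = \<theta>0 K u" "\<And>K. order_le m (\<theta>0 K)" "m < r"
    and vanish: "\<And>K. l < fst K \<Longrightarrow> \<theta>0 K = (\<lambda>u. 0)" "l < r" and u: "u \<in> D"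
  shows "lie_deriv_form r X \<theta> I u = lie_deriv_form r (total_derivative r) \<theta>0 I u"
proof -
  have "vf_apply r X (\<theta> I) u = vf_apply r (total_derivative r) (\<theta>0 I) u"
    using vf_apply_eq_total_derivative[OF X \<theta>(1) \<theta>(2,3) u] .
  moreover have "\<theta> K u * pd I (X K) u = \<theta>0 K u * pd I (total_derivative r K) u" for K
  proof (cases "fst K < r")
    case True
    then show ?thesis using \<theta>(1)[OF u] pd_cong_on[OF open_D u X] by simp
  next
    case False
    then show ?thesis using \<theta>(1)[OF u] vanish by simp
  qed
  ultimately show ?thesis by (simp add: lie_deriv_form_def)
qed

lemma homogeneous_total_derivative: "homogeneous (real (fst K) + 1) (total_derivative r K)"
proof (cases K)
  case (Pair \<gamma> i)
  have "homogeneous (real \<gamma> + 1) (\<lambda>u. (1 + real \<gamma>) * u (Suc \<gamma>, i))"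
    using homogeneous_cmult[OF homogeneous_coord[of "(Suc \<gamma>, i)"], of "1 + real \<gamma>"] by (simp add: add.commute)
  then show ?thesis unfolding Pair
    by (cases "\<gamma> < r") (simp_all add: total_derivative_def homogeneous_zero)
qed

lemma homogeneous_liouville:
  assumes "\<alpha> \<ge> 1"
  shows "homogeneous (real (fst K) + (1 - real \<alpha>)) (liouville r \<alpha> K)"
proof (cases K)
  case (Pair \<gamma> i)
  show ?thesis
  proof (cases "\<alpha> \<le> \<gamma> \<and> \<gamma> \<le> r")
    case True
    then have "liouville r \<alpha> K = (\<lambda>u. real (\<gamma> + 1 - \<alpha>) * u (\<gamma> + 1 - \<alpha>, i))"
      by (intro ext) (simp only: Pair liouville_apply[OF assms] simp_thms if_True)
    then show ?thesis
      using homogeneous_cmult[OF homogeneous_coord[of "(\<gamma> + 1 - \<alpha>, i)"], of "real (\<gamma> + 1 - \<alpha>)"] True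
      by (simp add: Pair of_nat_diff algebra_simps)
  next
    case False
    then have "liouville r \<alpha> K = (\<lambda>u. 0)" by (auto simp: fun_eq_iff Pair liouville_apply[OF assms])
    then show ?thesis by (simp add: homogeneous_zero)
  qed
qed

end

section \<open>Homogeneity of the Cartan form and of the energy\<close>

text \<open>The local expressions in one chart: \<open>f\<close> of the Lagrangian, \<open>X\<close> of the auxiliary
  semispray.\<close>

locale local_lagrangian = dilation_invariant_region D
  for D :: "'n::finite coords set" +
  fixes k :: nat and f :: "'n coords \<Rightarrow> real" and a :: real and X :: "'n local_field"
  assumes k: "k \<ge> 1" and f: "homogeneous a f" "order_le k f"
    and X: "\<And>K u. fst K < 2 * k - 1 \<Longrightarrow> u \<in> D \<Longrightarrow> X K u = total_derivative (2 * k - 1) K u"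
begin

abbreviation "r \<equiv> 2 * k - 1"

text \<open>Each Lie derivative raises the order of the coefficients, the highest level of the form and
  the degree by one. Replacing \<open>X\<close> by the total derivative in step \<open>n + 1\<close> requires
  \<open>k + n < 2k - 1\<close> and \<open>k - \<alpha> + n < 2k - 1\<close>; this holds since at most \<open>\<alpha> - 1 \<le> k - 1\<close>
  Lie derivatives are taken. The facts have to be proved together, as each step of the replacement
  uses the bounds on order and level.\<close>

lemma theta_summand:
  assumes "1 \<le> \<alpha>" "\<alpha> \<le> k" "n < \<alpha>"
  defines "\<theta> \<equiv> (lie_deriv_form r (total_derivative r) ^^ n) (d_J r \<alpha> f)"
  shows "(\<forall>I. order_le (k + n) (\<theta> I)) \<and>
         (\<forall>I. k - \<alpha> + n < fst I \<longrightarrow> \<theta> I = (\<lambda>u. 0)) \<and>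
         (\<forall>I. homogeneous (a - real \<alpha> + real n - real (fst I)) (\<theta> I)) \<and>
         (\<forall>I. \<forall>u\<in>D. (lie_deriv_form r X ^^ n) (d_J r \<alpha> f) I u = \<theta> I u)"
  unfolding \<theta>_def using assms(3)
proof (induction n)
  case 0
  have dJ: "d_J r \<alpha> f I = (if fst I + \<alpha> \<le> r then pd (fst I + \<alpha>, snd I) f else (\<lambda>u. 0))" for I
    by (cases I) (simp add: fun_eq_iff d_J_apply)
  have "order_le k (d_J r \<alpha> f I)" for I
    unfolding dJ by (simp add: order_le_pd f(2) order_le_const)
  moreover have "d_J r \<alpha> f I = (\<lambda>u. 0)" if "k - \<alpha> < fst I" for I
    using pd_above_order[OF f(2), of "(fst I + \<alpha>, snd I)"] that unfolding dJ by (simp add: fun_eq_iff)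
  moreover have "homogeneous (a - real \<alpha> - real (fst I)) (d_J r \<alpha> f I)" for I
    using homogeneous_pd[OF f(1), of "(fst I + \<alpha>, snd I)"]
    unfolding dJ by (simp add: homogeneous_zero algebra_simps)
  ultimately show ?case by (simp only: funpow_0 add_0_right of_nat_0) blast
next
  case (Suc n)
  let ?T = "total_derivative r :: 'n local_field"
  define \<theta> where "\<theta> = (lie_deriv_form r ?T ^^ n) (d_J r \<alpha> f)"
  define \<theta>X where "\<theta>X = (lie_deriv_form r X ^^ n) (d_J r \<alpha> f)"
  have bounds: "k + n < r" "k - \<alpha> + n < r" using Suc.prems assms(1,2) by auto
  have order: "order_le (k + n) (\<theta> K)"
    and vanish: "k - \<alpha> + n < fst K \<Longrightarrow> \<theta> K = (\<lambda>u. 0)"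
    and hom: "homogeneous (a - real \<alpha> + real n - real (fst K)) (\<theta> K)"
    and eq: "u \<in> D \<Longrightarrow> \<theta>X K u = \<theta> K u" for K u
    using Suc.IH Suc.prems unfolding \<theta>_def \<theta>X_def by auto
  have "order_le (k + Suc n) (lie_deriv_form r ?T \<theta> I)" for I
  proof -
    have "order_le (k + Suc n) (vf_apply r ?T (\<theta> I))"
      using order_le_vf_apply[OF order order_le_total_derivative le_add1] by simp
    moreover have "order_le (k + Suc n) (\<lambda>u. \<theta> K u * pd I (?T K) u)" for K
    proof (cases "fst K \<le> k + n")
      case True
      then show ?thesis
        using order_le_total_derivative[OF True, of r] order_le_mono[OF order, of "k + Suc n"]
        by (intro order_le_mult order_le_pd) auto
    next
      case False
      then have "\<theta> K = (\<lambda>u. 0)" using vanish by simp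
      then show ?thesis by (simp add: order_le_const)
    qed
    ultimately show ?thesis
      unfolding lie_deriv_form_def by (intro order_le_add order_le_sum)
  qed
  moreover have "lie_deriv_form r ?T \<theta> I = (\<lambda>u. 0)" if I: "k - \<alpha> + Suc n < fst I" for I
  proof -
    have "vf_apply r ?T (\<theta> I) u = 0" for u
      using vanish[of I] I by (simp add: vf_apply_def pd_def)
    moreover have "\<theta> K u * pd I (?T K) u = 0" for K u
    proof (cases "fst K \<le> k - \<alpha> + n")
      case True
      then have "pd I (?T K) u = 0"
        using pd_above_order[OF order_le_total_derivative[OF True]] I by simp
      then show ?thesis by simp
    next
      case False
      then show ?thesis using vanish by simp
    qed
    ultimately show ?thesis by (simp only: lie_deriv_form_def fun_eq_iff) simp
  qed
  moreover have "homogeneous (a - real \<alpha> + real (Suc n) - real (fst I)) (lie_deriv_form r ?T \<theta> I)" for I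
    using homogeneous_lie_deriv_form[OF homogeneous_total_derivative hom, of I, where r = r]
    by (simp add: algebra_simps)
  moreover have "lie_deriv_form r X \<theta>X I u = lie_deriv_form r ?T \<theta> I u" if "u \<in> D" for I u
    by (rule lie_deriv_form_eq_total_derivative[OF X eq order bounds(1) vanish bounds(2) that])
  ultimately show ?case
    unfolding funpow.simps comp_def \<theta>_def[symmetric] \<theta>X_def[symmetric] by blast
qed

text \<open>The operator \<open>d\<^bsub>J\<^sup>\<alpha>\<^esub>\<close> costs \<open>\<alpha>\<close> degrees, of which \<open>\<alpha> - 1\<close> are regained
  by the Lie derivatives, so all summands have the same degree.\<close>

lemma homogeneous_theta: "homogeneous (a - 1 - real (fst I)) (theta k X f I)"
proof (rule homogeneous_cong)
  let ?\<theta> = "\<lambda>\<alpha>. (lie_deriv_form r (total_derivative r) ^^ (\<alpha> - 1)) (d_J r \<alpha> f)"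
  show "homogeneous (a - 1 - real (fst I)) (\<lambda>u. \<Sum>\<alpha> = 1..k. (-1) ^ (\<alpha> - 1) / fact \<alpha> * ?\<theta> \<alpha> I u)"
  proof (intro homogeneous_sum homogeneous_cmult)
    fix \<alpha> assume "\<alpha> \<in> {1..k}"
    then show "homogeneous (a - 1 - real (fst I)) (?\<theta> \<alpha> I)"
      using theta_summand[of \<alpha> "\<alpha> - 1"] by (simp add: of_nat_diff algebra_simps)
  qed
  show "(\<Sum>\<alpha> = 1..k. (-1) ^ (\<alpha> - 1) / fact \<alpha> * ?\<theta> \<alpha> I u) = theta k X f I u" if "u \<in> D" for u
    unfolding theta_def
    by (intro sum.cong refl arg_cong2[where f = "(*)"]) (use that theta_summand in auto)
qed

lemma homogeneous_omega:
  "homogeneous (a - 1 - real (fst I) - real (fst K)) (omega k X f I K)"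
proof -
  have "homogeneous (a - 1 - real (fst I) - real (fst K)) (pd I (theta k X f K))"
    and "homogeneous (a - 1 - real (fst I) - real (fst K)) (pd K (theta k X f I))"
    using homogeneous_pd[OF homogeneous_theta, of I K] homogeneous_pd[OF homogeneous_theta, of K I]
    by (simp_all add: algebra_simps)
  then show ?thesis
    unfolding omega_def ext_d_def using homogeneous_diff by simp
qed

text \<open>As for the Cartan form: \<open>\<C>\<^sub>\<alpha>\<close> lowers the degree by \<open>\<alpha> - 1\<close> and preserves the order
  \<open>k\<close>, and each total derivative raises both by one.\<close>

lemma energy_summand:
  assumes "1 \<le> \<alpha>" "\<alpha> \<le> k" "n < \<alpha>"
  defines "g \<equiv> (vf_apply r (total_derivative r) ^^ n) (vf_apply r (liouville r \<alpha>) f)"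
  shows "order_le (k + n) g \<and> homogeneous (a + 1 - real \<alpha> + real n) g \<and>
         (\<forall>u\<in>D. (vf_apply r X ^^ n) (vf_apply r (liouville r \<alpha>) f) u = g u)"
  unfolding g_def using assms(3)
proof (induction n)
  case 0
  have "order_le k (liouville r \<alpha> K)" if "fst K \<le> k" for K :: "nat \<times> 'n"
    by (rule order_leI) (use that assms(1) in \<open>cases K; simp add: liouville_apply[OF assms(1)]\<close>)
  then have "order_le k (vf_apply r (liouville r \<alpha>) f)"
    using order_le_vf_apply[OF f(2)] by blast
  moreover have "homogeneous (a + 1 - real \<alpha>) (vf_apply r (liouville r \<alpha>) f)"
    using homogeneous_vf_apply[OF homogeneous_liouville[OF assms(1)] f(1), where r = r]
    by (simp add: algebra_simps)
  ultimately show ?case by simp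
next
  case (Suc n)
  let ?T = "total_derivative r :: 'n local_field"
  define g where "g = (vf_apply r ?T ^^ n) (vf_apply r (liouville r \<alpha>) f)"
  define gX where "gX = (vf_apply r X ^^ n) (vf_apply r (liouville r \<alpha>) f)"
  have bound: "k + n < r" using Suc.prems assms(1,2) by auto
  have order: "order_le (k + n) g" and hom: "homogeneous (a + 1 - real \<alpha> + real n) g"
    and eq: "u \<in> D \<Longrightarrow> gX u = g u" for u
    using Suc.IH Suc.prems unfolding g_def gX_def by auto
  have "order_le (k + Suc n) (vf_apply r ?T g)"
    using order_le_vf_apply[OF order order_le_total_derivative le_add1] by simp
  moreover have "homogeneous (a + 1 - real \<alpha> + real (Suc n)) (vf_apply r ?T g)"
    using homogeneous_vf_apply[OF homogeneous_total_derivative hom, where r = r]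
    by (simp add: algebra_simps)
  moreover have "vf_apply r X gX u = vf_apply r ?T g u" if "u \<in> D" for u
    by (rule vf_apply_eq_total_derivative[OF X eq order bound that])
  ultimately show ?case
    unfolding funpow.simps comp_def g_def[symmetric] gX_def[symmetric] by blast
qed

lemma homogeneous_energy: "homogeneous a (energy k X f)"
proof (rule homogeneous_cong)
  let ?g = "\<lambda>\<alpha>. (vf_apply r (total_derivative r) ^^ (\<alpha> - 1)) (vf_apply r (liouville r \<alpha>) f)"
  show "homogeneous a (\<lambda>u. (\<Sum>\<alpha> = 1..k. (-1) ^ (\<alpha> - 1) / fact \<alpha> * ?g \<alpha> u) - f u)"
  proof (intro homogeneous_diff homogeneous_sum homogeneous_cmult f)
    fix \<alpha> assume "\<alpha> \<in> {1..k}"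
    then show "homogeneous a (?g \<alpha>)"
      using energy_summand[of \<alpha> "\<alpha> - 1"] by (simp add: of_nat_diff algebra_simps)
  qed
  show "(\<Sum>\<alpha> = 1..k. (-1) ^ (\<alpha> - 1) / fact \<alpha> * ?g \<alpha> u) - f u = energy k X f u" if "u \<in> D" for u
    unfolding energy_def
    by (intro sum.cong refl arg_cong2[where f = "(-)"] arg_cong2[where f = "(*)"])
       (use that energy_summand in auto)
qed

text \<open>The rescaled components \<open>s\<^sup>-\<^sup>1\<^sup>-\<^sup>\<gamma> S\<^sup>I(h\<^sub>s u)\<close> solve the same linear system at \<open>u\<close> as
  the \<open>S\<^sup>I(u)\<close>, and \<open>\<omega>\<close> is non-degenerate.\<close>

lemma solution_components_dilation:
  assumes symplectic: "symplectic_on r D (omega k X f)"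
    and eq: "\<And>u K. u \<in> D \<Longrightarrow> K \<in> levels r \<Longrightarrow>
      contract r S (omega k X f) K u = pd K (energy k X f) u"
    and u: "u \<in> D" and s: "s > 0" and I: "I \<in> levels r"
  shows "S I (dilation s u) = s powr (real (fst I) + 1) * S I u"
proof -
  define v where "v = (\<lambda>I. s powr (- real (fst I) - 1) * S I (dilation s u) - S I u)"
  have "\<forall>K\<in>levels r. (\<Sum>I\<in>levels r. v I * omega k X f I K u) = 0"
  proof
    fix K :: "nat \<times> 'n" assume K: "K \<in> levels r"
    let ?\<omega> = "omega k X f"
    have "?\<omega> I K (dilation s u) = s powr (a - real (fst K)) * (s powr (- real (fst I) - 1) * ?\<omega> I K u)" for I
      using homogeneous_omega[of I K] u s
      by (simp add: homogeneous_def algebra_simps flip: powr_add)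
    then have "s powr (a - real (fst K)) *
        (\<Sum>I\<in>levels r. s powr (- real (fst I) - 1) * S I (dilation s u) * ?\<omega> I K u) =
        contract r S ?\<omega> K (dilation s u)"
      by (simp add: contract_def sum_distrib_left mult_ac)
    also have "\<dots> = pd K (energy k X f) (dilation s u)"
      by (rule eq[OF dilation_D[OF u s] K])
    also have "\<dots> = s powr (a - real (fst K)) * pd K (energy k X f) u"
      using homogeneous_pd[OF homogeneous_energy, of K] u s by (simp add: homogeneous_def)
    also have "\<dots> = s powr (a - real (fst K)) * (\<Sum>I\<in>levels r. S I u * ?\<omega> I K u)"
      using eq[OF u K] by (simp add: contract_def)
    finally have "(\<Sum>I\<in>levels r. s powr (- real (fst I) - 1) * S I (dilation s u) * ?\<omega> I K u) =
        (\<Sum>I\<in>levels r. S I u * ?\<omega> I K u)"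
      using s by simp
    then show "(\<Sum>I\<in>levels r. v I * ?\<omega> I K u) = 0"
      by (simp add: v_def left_diff_distrib sum_subtractf)
  qed
  then have "v I = 0" using symplectic u I unfolding symplectic_on_def by blast
  then have "S I u = s powr - (real (fst I) + 1) * S I (dilation s u)" by (simp add: v_def)
  then show ?thesis using s by (simp only: powr_minus) (simp add: field_simps)
qed

end

section \<open>Homogeneity of the canonical semispray\<close>

lemma open_coord_dom:
  assumes "open (chart_map c ` chart_dom c)"
  shows "open (coord_dom slit c)"
proof -
  have "continuous_on UNIV (\<lambda>u::'a coords. \<chi> i. u (0, i))"
    by (intro continuous_on_vec_lambda continuous_on_product_coordinates)
  then have "open ((\<lambda>u::'a coords. \<chi> i. u (0, i)) -` (chart_map c ` chart_dom c))"
    using assms by (rule open_vimage[rotated])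
  moreover have "open (\<Union>i. (\<lambda>u::'a coords. u (1, i)) -` (- {0}))"
    by (intro open_UN ballI open_vimage continuous_on_product_coordinates) auto
  moreover have "coord_dom slit c =
      (\<lambda>u. \<chi> i. u (0, i)) -` (chart_map c ` chart_dom c) \<inter>
      (if slit then \<Union>i. (\<lambda>u. u (1, i)) -` (- {0}) else UNIV)"
    by (auto simp: coord_dom_def)
  ultimately show ?thesis by (simp add: open_Int)
qed

lemma order_le_jet_param:
  fixes c :: "('a, 'n::finite) chart"
  shows "order_le r (\<lambda>u. F (jet_param A r c u))"
proof (rule order_leI)
  fix u v :: "'n coords" assume "\<And>K. fst K \<le> r \<Longrightarrow> u K = v K"
  then have "(\<Sum>\<alpha>\<le>r. t ^ \<alpha> *\<^sub>R (\<chi> i. u (\<alpha>, i))) = (\<Sum>\<alpha>\<le>r. t ^ \<alpha> *\<^sub>R (\<chi> i. v (\<alpha>, i)))" for t :: real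
    by (intro sum.cong) auto
  then show "F (jet_param A r c u) = F (jet_param A r c v)" by (simp add: jet_param_def)
qed

theorem proposition3p6:
  fixes M :: "'a topology"
    and A :: "('a, 'n::finite) chart set"
    and slit :: bool
    and k :: nat
    and L :: "'a jet \<Rightarrow> real"
    and S S' :: "('a, 'n) field"
    and a :: real
  assumes "smooth_manifold M A"
    and "k \<ge> 1"
    and "semispray A slit (2 * k - 1) S'"
    and "regular_lagrangian A slit k S' L"
    and "\<forall>c\<in>A. \<forall>u\<in>coord_dom slit c.
           vf_apply k (liouville k 1) (local_fun A k L c) u = a * local_fun A k L c u"
    and "a \<noteq> 1"
    and "canonical_semispray A slit k S' L S"
  shows "\<forall>c\<in>A. \<forall>u\<in>coord_dom slit c. \<forall>I\<in>levels (2 * k - 1).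
           lie_bracket (2 * k - 1) (liouville (2 * k - 1) 1) (local_vf A (2 * k - 1) S c) I u
             = local_vf A (2 * k - 1) S c I u"
proof (intro ballI)
  fix c u and I :: "nat \<times> 'n"
  assume c: "c \<in> A" and u: "u \<in> coord_dom slit c" and I: "I \<in> levels (2 * k - 1)"
  define r where "r = 2 * k - 1"
  define D where "D = coord_dom slit c"
  define f where "f = local_fun A k L c"
  define X where "X = local_vf A r S' c"
  define Y where "Y = local_vf A r S c"
  have region: "dilation_invariant_region D"
  proof
    show "open D" unfolding D_def
      by (rule open_coord_dom) (use assms(1) c in \<open>auto simp: smooth_manifold_def is_chart_def\<close>)
    show "dilation s u \<in> D" if "u \<in> D" "s > 0" for s u
      using that by (auto simp: D_def coord_dom_def dilation_def)
  qed
  interpret dilation_invariant_region D by (rule region)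
  have f: "homogeneous a f"
  proof (rule homogeneous_if_euler)
    show "smooth_coords D f"
      using assms(4) c by (simp add: regular_lagrangian_def smooth_function_def D_def f_def)
    show "order_le k f" unfolding f_def local_fun_def by (rule order_le_jet_param)
    show "vf_apply k (liouville k 1) f u = a * f u" if "u \<in> D" for u
      using assms(5) c that by (simp add: f_def D_def)
  qed
  interpret local_lagrangian D k f a X
  proof unfold_locales
    show "order_le k f" unfolding f_def local_fun_def by (rule order_le_jet_param)
    show "X K u = total_derivative (2 * k - 1) K u" if "fst K < 2 * k - 1" "u \<in> D" for K u
      using semispray_components[OF assms(3) c _ that(1)] that(2) by (simp add: X_def D_def r_def)
  qed (use assms(2) f in auto)
  have symplectic: "symplectic_on r D (omega k X f)"
    using assms(4) c by (simp add: regular_lagrangian_def r_def D_def X_def f_def)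
  have eq: "\<And>u K. u \<in> D \<Longrightarrow> K \<in> levels r \<Longrightarrow> contract r Y (omega k X f) K u = pd K (energy k X f) u"
    using assms(7) c by (simp add: canonical_semispray_def r_def D_def X_def Y_def f_def)
  have "smooth_coords D (Y I)"
    using assms(7) c I
    unfolding canonical_semispray_def semispray_def vector_field_def D_def Y_def r_def by blast
  moreover have "Y I (dilation s w) = s powr (real (fst I) + 1) * Y I w" if "w \<in> D" "s > 0" for w s
    by (rule solution_components_dilation[of Y, OF symplectic[unfolded r_def] eq[unfolded r_def] that I])
  ultimately have "homogeneous (real (fst I) + 1) (Y I)" by (simp add: homogeneous_def)
  moreover have "order_le r (Y I)" unfolding Y_def local_vf_def by (rule order_le_jet_param)
  ultimately show "lie_bracket (2 * k - 1) (liouville (2 * k - 1) 1) (local_vf A (2 * k - 1) S c) I u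
      = local_vf A (2 * k - 1) S c I u"
    using liouville_bracket[of I Y r u] I u unfolding Y_def r_def D_def by blast
qed

end
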